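(* Let $A$ be a symmetric positive definite $n\times n$ matrix with integer entries, let $u\in\mathbb{C}^n$, let $\tau$ be in the upper half-plane, and let $\epsilon\in\mathbb{C}^n$ satisfy $\mathrm{Re}(\epsilon_i)<0$ for all components $\epsilon_i$, $i=1,\dots,n$. Then $$P_\epsilon\left(\frac{u}{\tau},-\frac1\tau\right)=h_\epsilon(u,\tau).$$
   Context: Here $(x,y)=\sum_{j=1}^n x_jy_j$ is the standard $\mathbb{C}$-bilinear form on $\mathbb{C}^n$, $q=e^{2\pi i\tau}$ (and $q^a=e^{2\pi i\tau a}$), and $\sqrt{(-i\tau)^n/\det A}$ means $(\sqrt{-i\tau})^n/\sqrt{\det A}$ with principal branch of the square root. The regularized partial theta function is $$P_\epsilon(u,\tau)=\sum_{k\in(\mathbb{Z}_{\ge0}+\frac12)^n}q^{\frac12(k,Ak)}e^{2\pi i(k,Au)}e^{2\pi(k,\epsilon)},$$ and $$h_\epsilon(u,\tau)=e^{\frac{\pi i}{\tau}(u,Au)}(2i)^{-n}\sqrt{\frac{(-i\tau)^n}{\det A}}\int_{\mathbb{R}^n}\frac{q^{\frac12(w,A^{-1}w)}e^{-2\pi i(u,w)}}{\prod_{j=1}^n\sin(\pi(w_j-i\epsilon_j))}\,d^nw .$$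
   Formalization: The formal identity is P_ε(u/τ,−1/τ) = (−1)^n h_ε(u,τ): the sign (−1)^n is added because the printed identity fails for odd n (e.g. n=1, A=1, u=0, τ=i, ε=−1/2 gives h=−P≠0); for even n it is the printed claim. *)

theory Defs
  imports "HOL-Analysis.Analysis"
begin

definition pos_def_matrix :: "real ^ 'n ^ 'n \<Rightarrow> bool" where
  "pos_def_matrix A \<longleftrightarrow> (\<forall>x. x \<noteq> 0 \<longrightarrow> 0 < x \<bullet> (A *v x))"

(* The complex bilinear form on complex vectors. The library's inner product
   on complex ^ 'n is real-valued and is not this form. *)
definition cbilin :: "complex ^ 'n \<Rightarrow> complex ^ 'n \<Rightarrow> complex" where
  "cbilin x y = (\<Sum>j\<in>UNIV. x $ j * y $ j)"

definition cvec :: "real ^ 'n \<Rightarrow> complex ^ 'n" where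
  "cvec x = (\<chi> j. complex_of_real (x $ j))"

abbreviation cmat :: "real ^ 'n ^ 'm \<Rightarrow> complex ^ 'n ^ 'm" where
  "cmat A \<equiv> map_matrix complex_of_real A"

(* q^a for q = exp (2 pi i tau), with the branch fixed by tau *)
definition q_pow :: "complex \<Rightarrow> complex \<Rightarrow> complex" where
  "q_pow \<tau> a = exp (2 * of_real pi * \<i> * \<tau> * a)"

definition half_int_cone :: "(complex ^ 'n) set" where
  "half_int_cone = {k. \<forall>j. \<exists>m::nat. k $ j = of_nat m + 1 / 2}"

definition partial_theta ::
    "real ^ 'n ^ 'n \<Rightarrow> complex ^ 'n \<Rightarrow> complex ^ 'n \<Rightarrow> complex \<Rightarrow> complex" where
  "partial_theta A \<epsilon> u \<tau> =
     (\<Sum>\<^sub>\<infinity>k\<in>half_int_cone.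
        q_pow \<tau> (1 / 2 * cbilin k (cmat A *v k))
        * exp (2 * of_real pi * \<i> * cbilin k (cmat A *v u))
        * exp (2 * of_real pi * cbilin k \<epsilon>))"

(* For Re (\<epsilon> $ j) < 0 one has Im (w $ j - \<i> * \<epsilon> $ j) > 0, where 1 / sin (pi z) expands as
   -2 \<i> times the sum of exp (2 pi \<i> k z) over k = 1/2, 3/2, ... .  The prefactor (2 \<i>)^(-n)
   below therefore leaves a sign (-1)^n relative to the partial theta function. *)
definition theta_integral ::
    "real ^ 'n ^ 'n \<Rightarrow> complex ^ 'n \<Rightarrow> complex ^ 'n \<Rightarrow> complex \<Rightarrow> complex" where
  "theta_integral A \<epsilon> u \<tau> =
     exp (of_real pi * \<i> / \<tau> * cbilin u (cmat A *v u))
     * (1 / (2 * \<i>) ^ CARD('n))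
     * (csqrt (- \<i> * \<tau>) ^ CARD('n) / of_real (sqrt (det A)))
     * (LINT w|lborel.
          q_pow \<tau> (1 / 2 * cbilin (cvec w) (cmat (matrix_inv A) *v cvec w))
          * exp (- 2 * of_real pi * \<i> * cbilin u (cvec w))
          / (\<Prod>j\<in>UNIV. sin (of_real pi * (cvec w $ j - \<i> * \<epsilon> $ j))))"

end

theory Submission
  imports Defs "HOL-Complex_Analysis.Cauchy_Integral_Theorem" "HOL-Probability.Distributions"
    "HOL-Real_Asymp.Real_Asymp"
begin

text \<open>The identity is a Gaussian Fourier transform followed by a geometric series. Put
\<open>s = -\<i>\<tau>\<close>, so \<open>Re s > 0\<close>. Completing the square with the symmetry of \<open>A\<close>, the summand of
\<open>P\<^sub>\<epsilon>(u/\<tau>, -1/\<tau>)\<close> at \<open>k\<close> is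
\<open>e^{\<pi>\<i>(u,Au)/\<tau>} \<cdot> e^{-\<pi>(u-k,A(u-k))/s} \<cdot> e^{2\<pi>(k,\<epsilon>)}\<close>, and its Gaussian factor is, up to the constant
\<open>\<surd>(s^n/det A)\<close>, the Fourier integral of \<open>e^{-\<pi>s(w,A\<^sup>-\<^sup>1w)}\<close> at \<open>u - k\<close>
(\<open>partial_theta_term\<close>). Under the integral sign, \<open>k\<close> now occurs only in
\<open>e^{2\<pi>\<i>(k,w)} e^{2\<pi>(k,\<epsilon>)} = \<Prod>\<^sub>j e^{2\<pi>\<i>k\<^sub>jz\<^sub>j}\<close> with \<open>z\<^sub>j = w\<^sub>j - \<i>\<epsilon>\<^sub>j\<close>. Since \<open>Re \<epsilon>\<^sub>j < 0\<close>, each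
\<open>z\<^sub>j\<close> lies in the upper half-plane and the modulus of the product is a geometrically decaying function
of \<open>k\<close> alone. Hence sum and integral may be exchanged (\<open>has_bochner_integral_infsum\<close>), and the
sum over \<open>k\<close> is a product of geometric series
\<open>\<Sum>\<^sub>m e^{2\<pi>\<i>(m+1/2)z} = -1/(2\<i> sin \<pi>z)\<close> (\<open>half_integer_geometric_series\<close>). The \<open>n\<close> minus signs
are the factor \<open>(-1)^n\<close> of the theorem.

The Fourier transform (\<open>gaussian_fourier\<close>), with complex \<open>s\<close> and a complex argument, needs two ideas.

In one variable, \<open>\<integral> exp(-\<pi>(\<alpha>y+\<beta>)\<^sup>2) dy = 1/\<alpha>\<close> whenever \<open>\<bar>Im \<alpha>\<bar> < Re \<alpha>\<close>. This is a contour shift.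
The entire function \<open>exp(-\<pi>z\<^sup>2)\<close> has an entire primitive \<open>\<Phi>\<close>, so truncated integrals over both the
line \<open>\<alpha>y+\<beta>\<close> and the real line are differences of values of \<open>\<Phi>\<close>. The end points \<open>\<alpha>r+\<beta>\<close> and \<open>r\<close> lie
in a common convex part of the sector \<open>\<bar>Im z\<bar> < Re z\<close> on which the integrand tends to \<open>0\<close> much faster
than their distance grows (\<open>gaussian_primitive_ends\<close>).

In \<open>n\<close> variables, completing the square one coordinate at a time diagonalizes a positive definite form
by a product of shears (\<open>exists_unimodular_diagonalization\<close>). Each shear preserves Lebesgue
measure, because with the sheared coordinate integrated first it is a translation
(\<open>shear_preserves_lborel\<close>). As the product has determinant \<open>1\<close>, the diagonal entries multiply to the
determinant of the form, and the integral splits into the one-dimensional ones.\<close>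

section \<open>One-dimensional Gaussian integrals along complex lines\<close>

lemma gaussian_sector_bound:
  assumes "0 \<le> m" "m \<le> Re z - \<bar>Im z\<bar>"
  shows "norm (exp (- (of_real pi * z\<^sup>2))) \<le> exp (- pi * m\<^sup>2)"
proof -
  have "m * m \<le> (Re z - \<bar>Im z\<bar>) * (Re z + \<bar>Im z\<bar>)"
    using assms by (intro mult_mono) auto
  then have "m\<^sup>2 \<le> Re (z\<^sup>2)"
    by (simp add: power2_eq_square algebra_simps)
  then show ?thesis by (simp add: norm_exp_eq_Re)
qed

text \<open>By the mean value inequality the difference is at most \<open>\<bar>\<alpha>r+\<beta>-r\<bar>\<close>, which is linear in \<open>r\<close>, times the
supremum of the integrand between the two points. That supremum is superexponentially small:
both points lie in the convex set \<open>{z. Re z - \<bar>Im z\<bar> \<ge> m}\<close> for an \<open>m\<close> growing linearly in \<open>r\<close>.\<close>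

lemma gaussian_primitive_ends:
  fixes \<alpha> \<beta> :: complex
  assumes \<Phi>: "\<And>z. (\<Phi> has_field_derivative exp (- (of_real pi * z\<^sup>2))) (at z)"
    and \<alpha>: "\<bar>Im \<alpha>\<bar> < Re \<alpha>"
  shows "((\<lambda>r::real. \<Phi> (\<alpha> * of_real r + \<beta>) - \<Phi> (of_real r)) \<longlongrightarrow> 0) at_top"
proof -
  \<comment> \<open>a lower bound for \<open>Re z - \<bar>Im z\<bar>\<close> at both ends \<open>z = 1\<close> and \<open>z = \<alpha>\<close>; the term \<open>2 * norm \<beta>\<close> below
    absorbs the contribution of \<open>\<beta>\<close> to \<open>Re\<close> and to \<open>Im\<close>\<close>
  define \<delta> where "\<delta> = min 1 (Re \<alpha> - \<bar>Im \<alpha>\<bar>)"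
  define m where "m = (\<lambda>r::real. \<delta> * r - 2 * norm \<beta>)"
  have \<delta>: "\<delta> > 0" using \<alpha> by (simp add: \<delta>_def)
  have "eventually (\<lambda>r. norm (\<Phi> (\<alpha> * of_real r + \<beta>) - \<Phi> (of_real r))
          \<le> exp (- pi * (m r)\<^sup>2) * (norm (\<alpha> - 1) * r + norm \<beta>)) at_top"
    using eventually_ge_at_top[of "2 * norm \<beta> / \<delta>"] eventually_ge_at_top[of 0]
  proof eventually_elim
    case (elim r)
    have m0: "m r \<ge> 0" using elim \<delta> by (simp add: m_def field_simps)
    define S where "S = {z. m r \<le> Re z - \<bar>Im z\<bar>}"
    \<comment> \<open>an intersection of two half-planes, hence convex\<close>
    have S: "S = {z. (1 - \<i>) \<bullet> z \<ge> m r} \<inter> {z. (1 + \<i>) \<bullet> z \<ge> m r}"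
      by (auto simp: S_def inner_complex_def)
    have "convex S" unfolding S by (intro convex_Int convex_halfspace_ge)
    moreover have "of_real r \<in> S"
    proof -
      have "\<delta> * r \<le> 1 * r" using elim by (intro mult_right_mono) (auto simp: \<delta>_def)
      then show ?thesis by (simp add: S_def m_def) (smt (verit) norm_ge_zero)
    qed
    moreover have "\<alpha> * of_real r + \<beta> \<in> S"
    proof -
      have "\<delta> * r \<le> (Re \<alpha> - \<bar>Im \<alpha>\<bar>) * r"
        using elim by (intro mult_right_mono) (auto simp: \<delta>_def)
      moreover have "\<bar>Im \<alpha> * r + Im \<beta>\<bar> \<le> \<bar>Im \<alpha>\<bar> * r + norm \<beta>"
        using abs_triangle_ineq[of "Im \<alpha> * r" "Im \<beta>"] abs_Im_le_cmod[of \<beta>] elim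
        by (simp add: abs_mult)
      moreover have "- norm \<beta> \<le> Re \<beta>" using abs_Re_le_cmod[of \<beta>] by linarith
      ultimately show ?thesis by (simp add: S_def m_def algebra_simps)
    qed
    ultimately have "norm (\<Phi> (\<alpha> * of_real r + \<beta>) - \<Phi> (of_real r))
       \<le> exp (- pi * (m r)\<^sup>2) * norm ((\<alpha> * of_real r + \<beta>) - of_real r)"
      using gaussian_sector_bound[OF m0]
      by (intro field_differentiable_bound[where f' = "\<lambda>z. exp (- (of_real pi * z\<^sup>2))" and S = S])
        (auto simp: S_def intro: has_field_derivative_at_within \<Phi>)
    also have "norm ((\<alpha> * of_real r + \<beta>) - of_real r) \<le> norm (\<alpha> - 1) * r + norm \<beta>"
    proof -
      have "(\<alpha> * of_real r + \<beta>) - of_real r = (\<alpha> - 1) * of_real r + \<beta>" by (simp add: algebra_simps)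
      moreover have "norm ((\<alpha> - 1) * of_real r + \<beta>) \<le> norm (\<alpha> - 1) * r + norm \<beta>"
        using norm_triangle_ineq[of "(\<alpha> - 1) * of_real r" \<beta>] elim by (simp add: norm_mult)
      ultimately show ?thesis by (simp only:)
    qed
    finally show ?case by (simp add: mult_left_mono)
  qed
  moreover have "((\<lambda>r. exp (- pi * (m r)\<^sup>2) * (norm (\<alpha> - 1) * r + norm \<beta>)) \<longlongrightarrow> 0) at_top"
  proof -
    define a b where "a = norm (\<alpha> - 1)" and "b = norm \<beta>"
    have "((\<lambda>r. exp (- pi * (\<delta> * r - 2 * b)\<^sup>2) * (a * r + b)) \<longlongrightarrow> 0) at_top"
      using \<delta> pi_gt_zero by real_asymp
    then show ?thesis by (simp add: m_def a_def b_def)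
  qed
  ultimately show ?thesis by (rule Lim_null_comparison)
qed

text \<open>On the real line the modulus is the exponential of a quadratic polynomial with leading coefficient
\<open>-\<pi> Re (\<alpha>\<^sup>2) < 0\<close>, that is, a multiple of a normal density.\<close>

lemma integrable_complex_gaussian:
  fixes \<alpha> \<beta> :: complex
  assumes \<alpha>: "\<bar>Im \<alpha>\<bar> < Re \<alpha>"
  shows "integrable lborel (\<lambda>y::real. exp (- (of_real pi * (\<alpha> * of_real y + \<beta>)\<^sup>2)))"
proof -
  define a b where "a = Re (\<alpha>\<^sup>2)" and "b = Re (\<alpha> * \<beta>)"
  have a: "a > 0"
  proof -
    have "0 < (Re \<alpha> - \<bar>Im \<alpha>\<bar>) * (Re \<alpha> + \<bar>Im \<alpha>\<bar>)" using \<alpha> by (intro mult_pos_pos) auto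
    then show ?thesis by (simp add: a_def power2_eq_square algebra_simps)
  qed
  define \<sigma> where "\<sigma> = 1 / sqrt (2 * pi * a)"
  define C where "C = sqrt (2 * pi * \<sigma>\<^sup>2) * exp (- pi * (Re (\<beta>\<^sup>2) - b\<^sup>2 / a))"
  have \<sigma>2: "\<sigma>\<^sup>2 = 1 / (2 * pi * a)" and "\<sigma> > 0" using a by (auto simp: \<sigma>_def power_divide)
  have eq: "norm (exp (- (of_real pi * (\<alpha> * of_real y + \<beta>)\<^sup>2))) = C * normal_density (- b / a) \<sigma> y" for y
  proof -
    have "Re ((\<alpha> * of_real y + \<beta>)\<^sup>2) = a * y\<^sup>2 + 2 * b * y + Re (\<beta>\<^sup>2)"
      by (simp add: a_def b_def power2_eq_square algebra_simps)
    also have "\<dots> = a * (y - - b / a)\<^sup>2 + (Re (\<beta>\<^sup>2) - b\<^sup>2 / a)"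
      using a by (simp add: power2_eq_square field_simps)
    finally have "pi * Re ((\<alpha> * of_real y + \<beta>)\<^sup>2)
        = (y - - b / a)\<^sup>2 / (2 * \<sigma>\<^sup>2) + pi * (Re (\<beta>\<^sup>2) - b\<^sup>2 / a)"
      using a unfolding \<sigma>2 by (simp add: distrib_left)
    moreover have "sqrt (2 * pi * \<sigma>\<^sup>2) \<noteq> 0" using \<open>\<sigma> > 0\<close> by simp
    ultimately show ?thesis
      by (simp add: norm_exp_eq_Re C_def normal_density_def flip: exp_add)
  qed
  have "integrable lborel (\<lambda>y. C * normal_density (- b / a) \<sigma> y)"
    using \<open>\<sigma> > 0\<close> by simp
  then have "integrable lborel (\<lambda>y::real. norm (exp (- (of_real pi * (\<alpha> * of_real y + \<beta>)\<^sup>2))))"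
    unfolding eq .
  then show ?thesis by (subst (asm) integrable_norm_iff) simp_all
qed

lemma integral_complex_gaussian_limit:
  fixes \<alpha> \<beta> :: complex
  assumes \<Phi>: "\<And>z. (\<Phi> has_field_derivative exp (- (of_real pi * z\<^sup>2))) (at z)"
    and \<alpha>: "\<bar>Im \<alpha>\<bar> < Re \<alpha>"
  shows "((\<lambda>r. \<Phi> (\<alpha> * of_real r + \<beta>) - \<Phi> (- (\<alpha> * of_real r) + \<beta>)) \<longlongrightarrow>
           \<alpha> * (LINT y|lborel. exp (- (of_real pi * (\<alpha> * of_real y + \<beta>)\<^sup>2)))) at_top"
proof -
  define f where "f = (\<lambda>y::real. exp (- (of_real pi * (\<alpha> * of_real y + \<beta>)\<^sup>2)))"
  have int: "integrable lborel f" unfolding f_def using \<alpha> by (rule integrable_complex_gaussian)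
  have [measurable]: "f \<in> borel_measurable borel" unfolding f_def by simp
  have "((\<lambda>r. LINT y|lborel. indicator {-r..r} y *\<^sub>R f y) \<longlongrightarrow> integral\<^sup>L lborel f) at_top"
  proof (rule integral_dominated_convergence_at_top[where w = "\<lambda>y. norm (f y)"])
    show "AE y in lborel. ((\<lambda>r. indicator {-r..r} y *\<^sub>R f y) \<longlongrightarrow> f y) at_top"
    proof (rule AE_I2)
      fix y :: real
      have "eventually (\<lambda>r. indicator {-r..r} y *\<^sub>R f y = f y) at_top"
        using eventually_ge_at_top[of "\<bar>y\<bar>"] by eventually_elim (auto simp: indicator_def)
      then show "((\<lambda>r. indicator {-r..r} y *\<^sub>R f y) \<longlongrightarrow> f y) at_top"
        by (rule tendsto_eventually)
    qed
  qed (use int in \<open>auto simp: indicator_def\<close>)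
  then have "((\<lambda>r. \<alpha> * (LINT y|lborel. indicator {-r..r} y *\<^sub>R f y)) \<longlongrightarrow> \<alpha> * integral\<^sup>L lborel f) at_top"
    by (rule tendsto_mult_left)
  moreover have "eventually (\<lambda>r. \<alpha> * (LINT y|lborel. indicator {-r..r} y *\<^sub>R f y) =
      \<Phi> (\<alpha> * of_real r + \<beta>) - \<Phi> (- (\<alpha> * of_real r) + \<beta>)) at_top"
    using eventually_ge_at_top[of 0]
  proof eventually_elim
    case (elim r)
    have "((\<lambda>y. \<Phi> (\<alpha> * of_real y + \<beta>)) has_vector_derivative \<alpha> * f y) (at y within {-r..r})" for y
    proof -
      have "((\<lambda>z. \<Phi> (\<alpha> * z + \<beta>)) has_field_derivative exp (- (of_real pi * (\<alpha> * of_real y + \<beta>)\<^sup>2)) * \<alpha>) (at (of_real y))"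
        by (rule DERIV_chain'[where g = \<Phi>, OF _ \<Phi>]) (auto intro!: derivative_eq_intros)
      then have "((\<lambda>y. \<Phi> (\<alpha> * of_real y + \<beta>)) has_vector_derivative exp (- (of_real pi * (\<alpha> * of_real y + \<beta>)\<^sup>2)) * \<alpha>) (at y)"
        using has_vector_derivative_real_field by blast
      then show ?thesis by (auto simp: f_def mult.commute intro: has_vector_derivative_at_within)
    qed
    then have "(LINT y|lborel. indicator {-r..r} y *\<^sub>R (\<alpha> * f y)) = \<Phi> (\<alpha> * of_real r + \<beta>) - \<Phi> (\<alpha> * of_real (-r) + \<beta>)"
      using elim by (intro integral_FTC_Icc) (auto simp: f_def intro!: continuous_intros)
    also have "(LINT y|lborel. indicator {-r..r} y *\<^sub>R (\<alpha> * f y)) = \<alpha> * (LINT y|lborel. indicator {-r..r} y *\<^sub>R f y)"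
      by (simp flip: integral_mult_right_zero)
    finally show ?case by simp
  qed
  ultimately show ?thesis unfolding f_def by (blast intro: Lim_transform_eventually)
qed

text \<open>The value does not depend on \<open>\<alpha>\<close> and \<open>\<beta>\<close> after multiplication by \<open>\<alpha>\<close>, since the end point
contributions of the two lines cancel in the limit; the case \<open>\<alpha> = 1\<close>, \<open>\<beta> = 0\<close> is the total mass of a
normal density.\<close>

lemma integral_complex_gaussian:
  fixes \<alpha> \<beta> :: complex
  assumes \<alpha>: "\<bar>Im \<alpha>\<bar> < Re \<alpha>"
  shows "(LINT y|lborel. exp (- (of_real pi * (\<alpha> * of_real y + \<beta>)\<^sup>2))) = 1 / \<alpha>"
proof -
  obtain \<Phi> :: "complex \<Rightarrow> complex" where \<Phi>: "\<And>z. (\<Phi> has_field_derivative exp (- (of_real pi * z\<^sup>2))) (at z)"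
  proof (rule holomorphic_convex_primitive'[OF convex_UNIV open_UNIV])
    show "(\<lambda>z. exp (- (of_real pi * z\<^sup>2))) holomorphic_on UNIV" by (intro holomorphic_intros)
  qed (auto intro: that)
  \<comment> \<open>the reflected primitive moves the left end points into the right-hand sector\<close>
  have \<Psi>: "((\<lambda>z. - \<Phi> (- z)) has_field_derivative exp (- (of_real pi * z\<^sup>2))) (at z)" for z
  proof -
    have "((\<lambda>z. \<Phi> (- z)) has_field_derivative exp (- (of_real pi * (- z)\<^sup>2)) * - 1) (at z)"
      by (rule DERIV_chain'[where g = \<Phi>, OF _ \<Phi>]) (auto intro!: derivative_eq_intros)
    then show ?thesis using DERIV_minus by fastforce
  qed
  let ?I = "\<lambda>\<alpha> \<beta>. \<alpha> * (LINT y|lborel. exp (- (of_real pi * (\<alpha> * of_real y + \<beta>)\<^sup>2)))"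
  have "((\<lambda>r. (\<Phi> (\<alpha> * of_real r + \<beta>) - \<Phi> (- (\<alpha> * of_real r) + \<beta>))
      - (\<Phi> (1 * of_real r + 0) - \<Phi> (- (1 * of_real r) + 0))) \<longlongrightarrow> ?I \<alpha> \<beta> - ?I 1 0) at_top"
    by (intro tendsto_diff integral_complex_gaussian_limit \<Phi> \<alpha>) simp
  moreover have "((\<lambda>r. (\<Phi> (\<alpha> * of_real r + \<beta>) - \<Phi> (of_real r)) +
       ((- \<Phi> (- (\<alpha> * of_real r + - \<beta>))) - (- \<Phi> (- of_real r)))) \<longlongrightarrow> 0 + 0) at_top"
    by (intro tendsto_add gaussian_primitive_ends[OF \<Phi> \<alpha>] gaussian_primitive_ends[OF \<Psi> \<alpha>])
  ultimately have "?I \<alpha> \<beta> - ?I 1 0 = 0"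
    by (intro tendsto_unique[of at_top]) (simp_all add: algebra_simps)
  moreover have "(LINT y|lborel. exp (- (of_real pi * (1 * complex_of_real y + 0)\<^sup>2))) = 1"
  proof -
    have "exp (- (of_real pi * (1 * complex_of_real y + 0)\<^sup>2)) = complex_of_real (normal_density 0 (1 / sqrt (2 * pi)) y)" for y
      by (simp add: normal_density_def power_divide exp_of_real[symmetric] mult.commute)
    then show ?thesis by simp
  qed
  moreover have "\<alpha> \<noteq> 0" using \<alpha> by auto
  ultimately show ?thesis by (simp add: field_simps)
qed

text \<open>Completing the square: the linear term is a shift of the contour by \<open>\<i>c/a\<close>.\<close>

lemma gaussian_fourier_real_line:
  fixes a c :: complex
  assumes a: "\<bar>Im a\<bar> < Re a"
  shows "has_bochner_integral lborel (\<lambda>y::real. exp (- (of_real pi * a\<^sup>2 * (of_real y)\<^sup>2) - 2 * of_real pi * \<i> * c * of_real y))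
           (exp (- (of_real pi * c\<^sup>2 / a\<^sup>2)) / a)"
proof -
  have [simp]: "a \<noteq> 0" using a by auto
  have eq: "exp (- (of_real pi * a\<^sup>2 * (of_real y)\<^sup>2) - 2 * of_real pi * \<i> * c * of_real y) =
      exp (- (of_real pi * (a * of_real y + \<i> * c / a)\<^sup>2)) * exp (- (of_real pi * c\<^sup>2 / a\<^sup>2))" for y :: real
    unfolding exp_add[symmetric] by (rule arg_cong[where f = exp]) (simp add: power2_eq_square field_simps)
  have "has_bochner_integral lborel (\<lambda>y::real. exp (- (of_real pi * (a * of_real y + \<i> * c / a)\<^sup>2)) * exp (- (of_real pi * c\<^sup>2 / a\<^sup>2)))
      (1 / a * exp (- (of_real pi * c\<^sup>2 / a\<^sup>2)))"
    using integrable_complex_gaussian[OF a] integral_complex_gaussian[OF a]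
    by (intro has_bochner_integral_mult_left) (simp add: has_bochner_integral_iff)
  then show ?thesis unfolding eq by simp
qed

text \<open>This makes \<open>csqrt s\<close> an admissible \<open>a\<close> in the preceding lemma.\<close>

lemma csqrt_in_sector: assumes "Re s > 0" shows "\<bar>Im (csqrt s)\<bar> < Re (csqrt s)"
proof -
  have "Re (csqrt s) \<ge> 0" by (rule Re_csqrt)
  moreover have "Re ((csqrt s)\<^sup>2) > 0" using assms by simp
  then have "\<bar>Im (csqrt s)\<bar>\<^sup>2 < (Re (csqrt s))\<^sup>2"
    by (simp add: power2_eq_square del: power2_csqrt)
  ultimately show ?thesis by (rule power2_less_imp_less[rotated])
qed

section \<open>Lebesgue measure in coordinates and under shears\<close>

lemma measurable_vec_lambda:
  "(\<lambda>f. \<chi> j. f j) \<in> Pi\<^sub>M UNIV (\<lambda>_::'n::finite. lborel :: real measure) \<rightarrow>\<^sub>M borel"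
  by (subst borel_measurable_euclidean_space) (auto simp: Basis_vec_def inner_axis)

lemma lborel_vec_eq:
  "(lborel :: (real ^ 'n) measure) = distr (Pi\<^sub>M UNIV (\<lambda>_. lborel)) borel (\<lambda>f. \<chi> j. f j)"
proof (rule lborel_eqI)
  interpret product_sigma_finite "\<lambda>_::'n. lborel :: real measure" ..
  fix l u :: "real ^ 'n"
  assume le: "\<And>b. b \<in> Basis \<Longrightarrow> l \<bullet> b \<le> u \<bullet> b"
  have lu: "l $ j \<le> u $ j" for j
    using le[of "axis j 1"] by (simp add: inner_axis axis_in_Basis_iff)
  have "emeasure (distr (Pi\<^sub>M UNIV (\<lambda>_. lborel)) borel (\<lambda>f. \<chi> j. f j)) (box l u)
      = emeasure (Pi\<^sub>M UNIV (\<lambda>_. lborel)) (\<Pi>\<^sub>E j\<in>UNIV. {l $ j <..< u $ j})"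
    by (subst emeasure_distr[OF measurable_vec_lambda])
      (auto simp: space_PiM mem_box_cart PiE_iff intro!: arg_cong2[where f = emeasure])
  also have "\<dots> = (\<Prod>j\<in>UNIV. ennreal ((u - l) $ j))"
    using lu by (subst emeasure_PiM) auto
  also have "\<dots> = ennreal (\<Prod>j\<in>UNIV. (u - l) $ j)"
    using lu by (intro prod_ennreal) auto
  also have "(\<Prod>j\<in>UNIV. (u - l) $ j) = (\<Prod>b\<in>Basis. (u - l) \<bullet> b)"
  proof -
    have "(Basis :: (real ^ 'n) set) = range (\<lambda>j. axis j 1)" by (auto simp: Basis_vec_def)
    then have "(\<Prod>b\<in>Basis. (u - l) \<bullet> b) = (\<Prod>b\<in>range (\<lambda>j. axis j 1). (u - l) \<bullet> b)"
      by (rule arg_cong)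
    also have "\<dots> = (\<Prod>j\<in>UNIV. (u - l) $ j)"
      by (subst prod.reindex) (auto simp: inj_on_def axis_eq_axis inner_axis)
    finally show ?thesis ..
  qed
  finally show "emeasure (distr (Pi\<^sub>M UNIV (\<lambda>_. lborel)) borel (\<lambda>f. \<chi> j. f j)) (box l u)
      = (\<Prod>b\<in>Basis. (u - l) \<bullet> b)" .
qed simp

lemma has_bochner_integral_prod_coords:
  fixes f :: "'n::finite \<Rightarrow> real \<Rightarrow> 'b::{real_normed_field,banach,second_countable_topology}"
  assumes f: "\<And>j. has_bochner_integral lborel (f j) (I j)"
  shows "has_bochner_integral lborel (\<lambda>x::real^'n. \<Prod>j\<in>UNIV. f j (x $ j)) (\<Prod>j\<in>UNIV. I j)"
proof -
  interpret product_sigma_finite "\<lambda>_::'n. lborel :: real measure" ..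
  have int: "integrable lborel (f j)" "integral\<^sup>L lborel (f j) = I j" for j
    using f[of j] by (auto simp: has_bochner_integral_iff)
  have [measurable]: "f j \<in> borel_measurable borel" for j
    using borel_measurable_integrable[OF int(1)[of j]] by simp
  have m: "(\<lambda>x::real^'n. \<Prod>j\<in>UNIV. f j (x $ j)) \<in> borel_measurable borel"
    by measurable
  have "has_bochner_integral (Pi\<^sub>M UNIV (\<lambda>_. lborel)) (\<lambda>x. \<Prod>j\<in>UNIV. f j (x j)) (\<Prod>j\<in>UNIV. I j)"
    using int by (simp add: has_bochner_integral_iff product_integrable_prod product_integral_prod)
  then show ?thesis
    using m unfolding lborel_vec_eq has_bochner_integral_iff
    by (subst integrable_distr_eq[OF measurable_vec_lambda], simp, subst integral_distr[OF measurable_vec_lambda]) auto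
qed

text \<open>The amount \<open>g x\<close> of the shear does not change along the \<open>i\<close>-th coordinate, so on every line in that
direction the map is a translation, and the one-dimensional measure is translation invariant.\<close>

lemma shear_preserves_lborel:
  fixes g :: "real ^ 'n \<Rightarrow> real"
  assumes g[measurable]: "g \<in> borel_measurable borel"
    and indep: "\<And>x t. g (x + t *\<^sub>R axis i 1) = g x"
  shows "distr lborel borel (\<lambda>x. x + g x *\<^sub>R axis i 1) = lborel"
proof (rule measure_eqI)
  interpret product_sigma_finite "\<lambda>_::'n. lborel :: real measure" ..
  fix X :: "(real ^ 'n) set" assume "X \<in> sets (distr lborel borel (\<lambda>x. x + g x *\<^sub>R axis i 1))"
  then have X[measurable]: "X \<in> sets borel" by simp
  let ?v = "\<lambda>f::'n \<Rightarrow> real. \<chi> j. f j" and ?P = "\<lambda>I::'n set. Pi\<^sub>M I (\<lambda>_. lborel :: real measure)"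
  have UN: "insert i (UNIV - {i}) = (UNIV :: 'n set)" by auto
  \<comment> \<open>Fubini with the sheared coordinate innermost\<close>
  have fub: "(\<integral>\<^sup>+x. h x \<partial>lborel) = (\<integral>\<^sup>+f. \<integral>\<^sup>+y. h (?v (f(i := y))) \<partial>lborel \<partial>?P (UNIV - {i}))"
    if [measurable]: "h \<in> borel_measurable borel" for h :: "real ^ 'n \<Rightarrow> ennreal"
  proof -
    note [measurable] = measurable_vec_lambda
    have "(\<integral>\<^sup>+x. h x \<partial>lborel) = (\<integral>\<^sup>+f. h (?v f) \<partial>?P UNIV)"
      by (subst lborel_vec_eq, subst nn_integral_distr) measurable
    also have "\<dots> = (\<integral>\<^sup>+f. h (?v f) \<partial>?P (insert i (UNIV - {i})))" unfolding UN ..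
    also have "\<dots> = (\<integral>\<^sup>+f. \<integral>\<^sup>+y. h (?v (f(i := y))) \<partial>lborel \<partial>?P (UNIV - {i}))"
      by (subst product_nn_integral_insert) (auto simp: UN)
    finally show ?thesis .
  qed
  have shift: "?v (f(i := y)) + g (?v (f(i := y))) *\<^sub>R axis i 1 = ?v (f(i := g (?v (f(i := 0))) + 1 * y))" for f y
  proof -
    have "?v (f(i := y)) = ?v (f(i := 0)) + y *\<^sub>R axis i 1"
      by (simp add: vec_eq_iff axis_def)
    then have "g (?v (f(i := y))) = g (?v (f(i := 0)))" by (simp add: indep)
    then show ?thesis by (simp add: vec_eq_iff axis_def)
  qed
  have "emeasure (distr lborel borel (\<lambda>x. x + g x *\<^sub>R axis i 1)) X = (\<integral>\<^sup>+x. indicator X (x + g x *\<^sub>R axis i 1) \<partial>lborel)"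
    by (subst nn_integral_indicator[symmetric], simp, subst nn_integral_distr) measurable
  also have "\<dots> = (\<integral>\<^sup>+f. \<integral>\<^sup>+y. indicator X (?v (f(i := g (?v (f(i := 0))) + 1 * y))) \<partial>lborel \<partial>?P (UNIV - {i}))"
    by (subst fub, measurable) (simp only: shift)
  also have "\<dots> = (\<integral>\<^sup>+f. \<integral>\<^sup>+y. indicator X (?v (f(i := y))) \<partial>lborel \<partial>?P (UNIV - {i}))"
  proof (rule nn_integral_cong)
    fix f :: "'n \<Rightarrow> real"
    have "continuous_on UNIV (\<lambda>y. (f(i := y)) j)" for j
      by (cases "j = i") simp_all
    then have "(\<lambda>y. ?v (f(i := y))) \<in> borel_measurable borel"
      by (intro borel_measurable_continuous_onI continuous_on_vec_lambda)
    then have "(\<lambda>y. indicator X (?v (f(i := y))) :: ennreal) \<in> borel_measurable borel" by measurable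
    from nn_integral_real_affine[OF this, of 1 "g (?v (f(i := 0)))"]
    show "(\<integral>\<^sup>+y. indicator X (?v (f(i := g (?v (f(i := 0))) + 1 * y))) \<partial>lborel) = (\<integral>\<^sup>+y. indicator X (?v (f(i := y))) \<partial>lborel)"
      by simp
  qed
  also have "\<dots> = emeasure lborel X"
    using X by (subst fub[symmetric]) auto
  finally show "emeasure (distr lborel borel (\<lambda>x. x + g x *\<^sub>R axis i 1)) X = emeasure lborel X" .
qed simp

section \<open>Diagonalizing a positive definite form by shears\<close>

lemma quadratic_form_congruence:
  fixes B M :: "real ^ 'n ^ 'n"
  shows "(M *v y) \<bullet> (B *v (M *v y)) = y \<bullet> ((transpose M ** B ** M) *v y)"
  by (simp add: matrix_vector_mul_assoc[symmetric])
    (metis dot_lmul_matrix inner_commute transpose_matrix_vector)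

lemma pos_def_congruence_diagonal:
  fixes B M :: "real ^ 'n ^ 'n"
  assumes pos: "pos_def_matrix B" and M: "det M \<noteq> 0"
  shows "0 < (transpose M ** B ** M) $ i $ i"
proof -
  have "invertible M" using M by (simp add: invertible_det_nz)
  then have "M *v axis i 1 \<noteq> 0"
    by (metis axis_eq_0_iff invertible_def matrix_vector_mul_assoc matrix_vector_mul_lid
        matrix_vector_mult_0_right zero_neq_one)
  then have "0 < (M *v axis i 1) \<bullet> (B *v (M *v axis i 1))"
    using pos by (simp add: pos_def_matrix_def)
  then show ?thesis
    unfolding quadratic_form_congruence
    by (simp add: inner_axis' matrix_vector_mul_component column_def matrix_vector_mult_basis)
qed

text \<open>Induction over the set of coordinates already split off. To split off \<open>i\<close>, complete the square in
that coordinate: the shear \<open>E\<close> subtracts from \<open>x\<^sub>i\<close> the combination of the others that kills the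
\<open>i\<close>-th row of the form. Rows that are already diagonal stay so, because their entry in column \<open>i\<close> is
\<open>0\<close>. Shears are preferred to an orthogonal diagonalization because both their determinant and their
effect on Lebesgue measure can be read off directly.\<close>

lemma exists_unimodular_diagonalization:
  fixes B :: "real ^ 'n ^ 'n"
  assumes sym: "transpose B = B" and pos: "pos_def_matrix B"
  obtains M where "det M = 1" "distr lborel borel ((*v) M) = lborel"
    "\<And>i j. i \<noteq> j \<Longrightarrow> (transpose M ** B ** M) $ i $ j = 0"
proof -
  have "\<exists>M. det M = 1 \<and> distr lborel borel ((*v) M) = lborel \<and>
          (\<forall>i\<in>S. \<forall>j. i \<noteq> j \<longrightarrow> (transpose M ** B ** M) $ i $ j = 0)" for S :: "'n set"
    using finite[of S]
  proof induction
    case empty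
    have "distr lborel borel ((*v) (mat 1 :: real ^ 'n ^ 'n)) = lborel"
    proof -
      have "(*v) (mat 1 :: real ^ 'n ^ 'n) = (\<lambda>x. x)" by (simp add: fun_eq_iff)
      then show ?thesis by (simp only:) (rule distr_id2, simp)
    qed
    then show ?case by (intro exI[of _ "mat 1"] conjI det_I ballI) (assumption | erule emptyE)+
  next
    case (insert i S)
    then obtain M where M: "det M = 1" "distr lborel borel ((*v) M) = lborel"
      and zero: "\<And>k j. k \<in> S \<Longrightarrow> k \<noteq> j \<Longrightarrow> (transpose M ** B ** M) $ k $ j = 0" by blast
    define C where "C = transpose M ** B ** M"
    have C_sym: "C $ k $ j = C $ j $ k" for k j
    proof -
      have "transpose C = C" by (simp add: C_def matrix_transpose_mul sym matrix_mul_assoc)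
      then show ?thesis by (metis transpose_def vec_lambda_beta)
    qed
    have Cii: "C $ i $ i > 0"
      unfolding C_def using M(1) by (intro pos_def_congruence_diagonal pos) simp
    \<comment> \<open>\<open>r\<close> vanishes at \<open>i\<close>, so that adding multiples of the other rows leaves the determinant of \<open>E\<close> unchanged
      and the shear does not depend on \<open>x\<^sub>i\<close>\<close>
    define r where "r = (\<lambda>j. if j = i then 0 else - C $ i $ j / C $ i $ i)"
    define E :: "real ^ 'n ^ 'n" where
      "E = (\<chi> k. if k = i then axis i 1 + (\<Sum>j\<in>UNIV. r j *s axis j 1) else axis k 1)"
    have E: "E $ k $ j = of_bool (k = j) + of_bool (k = i) * r j" for k j
    proof -
      have "(\<Sum>l\<in>UNIV. r l * axis l 1 $ j) = (\<Sum>l\<in>UNIV. if l = j then r l else 0)"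
        by (intro sum.cong) (auto simp: axis_def)
      then show ?thesis by (auto simp: E_def axis_def)
    qed
    have det_E: "det E = 1"
    proof -
      have row: "row k (mat 1 :: real ^ 'n ^ 'n) = axis k 1" for k
        by (auto simp: row_def mat_def axis_def vec_eq_iff)
      have "(\<Sum>j\<in>UNIV. r j *s axis j 1) \<in> vec.span {row j (mat 1 :: real ^ 'n ^ 'n) |j. j \<noteq> i}"
      proof (rule vec.span_sum)
        fix j show "r j *s axis j 1 \<in> vec.span {row j (mat 1 :: real ^ 'n ^ 'n) |j. j \<noteq> i}"
        proof (cases "j = i")
          case True then show ?thesis by (simp add: r_def vec.span_zero)
        next
          case False
          then show ?thesis unfolding row by (intro vec.span_scale vec.span_base) blast
        qed
      qed
      from det_row_span[OF this] show ?thesis unfolding row E_def by simp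
    qed
    have distr_E: "distr lborel borel ((*v) E) = lborel"
    proof -
      define g where "g = (\<lambda>x :: real ^ 'n. \<Sum>j\<in>UNIV. r j * x $ j)"
      have "(*v) E = (\<lambda>x. x + g x *\<^sub>R axis i 1)"
        by (simp add: fun_eq_iff vec_eq_iff matrix_vector_mult_def E g_def algebra_simps sum.distrib axis_def
            flip: sum_distrib_left)
      moreover have "g (x + t *\<^sub>R axis i 1) = g x" for x t
        unfolding g_def by (intro sum.cong) (auto simp: r_def axis_def)
      moreover have "g \<in> borel_measurable borel" unfolding g_def by measurable
      ultimately show ?thesis using shear_preserves_lborel[of g i] by simp
    qed
    have "distr lborel borel ((*v) (M ** E)) = lborel"
    proof -
      have meas: "(*v) N \<in> borel_measurable borel" for N :: "real ^ 'n ^ 'n"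
        by (intro borel_measurable_continuous_onI linear_continuous_on) (simp add: linear_linear)
      have "distr (distr lborel borel ((*v) E)) borel ((*v) M) = distr lborel borel ((*v) M \<circ> (*v) E)"
        by (intro distr_distr) (auto simp: meas)
      then show ?thesis
        using distr_E M(2) by (simp add: comp_def matrix_vector_mul_assoc)
    qed
    moreover have "(transpose (M ** E) ** B ** (M ** E)) $ k $ j = 0" if "k \<in> insert i S" "k \<noteq> j" for k j
    proof -
      have "transpose (M ** E) ** B ** (M ** E) = transpose E ** C ** E"
        by (simp add: C_def matrix_transpose_mul matrix_mul_assoc)
      moreover have "(transpose E ** C ** E) $ k $ j = C $ k $ j + r k * C $ i $ j + (C $ k $ i + r k * C $ i $ i) * r j"
      proof -
        have "(transpose E ** C) $ k $ b = (\<Sum>l\<in>UNIV. of_bool (l = k) * C $ l $ b + of_bool (l = i) * (r k * C $ l $ b))" for b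
          by (simp add: matrix_matrix_mult_def transpose_def E distrib_right mult.assoc)
        then have L: "(transpose E ** C) $ k $ b = C $ k $ b + r k * C $ i $ b" for b
          by (simp add: sum.distrib)
        have "(transpose E ** C ** E) $ k $ j = (\<Sum>l\<in>UNIV. of_bool (l = j) * (transpose E ** C) $ k $ l
            + of_bool (l = i) * ((transpose E ** C) $ k $ l * r j))"
          by (simp add: matrix_matrix_mult_def[of "transpose E ** C"] E distrib_left mult_ac)
        then show ?thesis by (simp add: sum.distrib L)
      qed
      moreover have "C $ k $ j + r k * C $ i $ j + (C $ k $ i + r k * C $ i $ i) * r j = 0"
      proof (cases "k = i")
        case True
        then show ?thesis using that Cii by (simp add: r_def)
      next
        case False
        then have "C $ k $ i = 0" "C $ k $ j = 0" using that zero[of k] by (auto simp: C_def)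
        then show ?thesis using False C_sym[of i k] by (simp add: r_def)
      qed
      ultimately show ?thesis by simp
    qed
    ultimately show ?case using M(1) det_E by (intro exI[of _ "M ** E"]) (auto simp: det_mul)
  qed
  from this[of UNIV] show ?thesis using that by auto
qed

section \<open>The Gaussian Fourier transform in several variables\<close>

lemma cbilin_cvec_matrix_vector: "cbilin v (cvec (M *v y)) = (\<Sum>j\<in>UNIV. (\<Sum>i\<in>UNIV. v $ i * of_real (M $ i $ j)) * of_real (y $ j))"
proof -
  have "cbilin v (cvec (M *v y)) = (\<Sum>i\<in>UNIV. \<Sum>j\<in>UNIV. v $ i * of_real (M $ i $ j) * of_real (y $ j))"
    by (simp add: cbilin_def cvec_def matrix_vector_mult_def sum_distrib_left mult_ac)
  then show ?thesis by (subst (asm) sum.swap) (simp add: sum_distrib_right)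
qed

text \<open>Substituting \<open>w = M y\<close> with \<open>M\<close> as in \<open>exists_unimodular_diagonalization\<close> turns the exponent into a
sum of functions of the single \<open>y\<^sub>j\<close>, with quadratic coefficients \<open>s d\<^sub>j\<close> and frequencies
\<open>c = M\<^sup>T v\<close>. The result is rewritten in terms of \<open>A\<close> and \<open>B\<close> by \<open>det B = \<Prod>\<^sub>j d\<^sub>j\<close> and
\<open>A = B\<^sup>-\<^sup>1 = M D\<^sup>-\<^sup>1 M\<^sup>T\<close> for \<open>D = diag d\<close>.\<close>

lemma gaussian_fourier:
  fixes A B :: "real ^ 'n ^ 'n" and v :: "complex ^ 'n" and s :: complex
  assumes sym: "transpose B = B" and pos: "pos_def_matrix B" and AB: "A ** B = mat 1" and s: "Re s > 0"
  shows "has_bochner_integral lborel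
     (\<lambda>w. exp (- (of_real pi * s * of_real (w \<bullet> (B *v w))) - 2 * of_real pi * \<i> * cbilin v (cvec w)))
     (exp (- (of_real pi / s * cbilin v (cmat A *v v))) / (csqrt s ^ CARD('n) * of_real (sqrt (det B))))"
proof -
  obtain M where M: "det M = 1" "distr lborel borel ((*v) M) = lborel"
    and off: "\<And>i j. i \<noteq> j \<Longrightarrow> (transpose M ** B ** M) $ i $ j = 0"
    by (rule exists_unimodular_diagonalization[OF sym pos]) blast
  define C where "C = transpose M ** B ** M"
  define d where "d = (\<lambda>j. C $ j $ j)"
  have C: "C $ i $ j = (if i = j then d i else 0)" for i j
    using off by (auto simp: C_def d_def)
  have form: "(M *v y) \<bullet> (B *v (M *v y)) = (\<Sum>j\<in>UNIV. d j * (y $ j)\<^sup>2)" for y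
  proof -
    have "(M *v y) \<bullet> (B *v (M *v y)) = y \<bullet> (C *v y)"
      unfolding C_def by (rule quadratic_form_congruence)
    also have "\<dots> = (\<Sum>j\<in>UNIV. d j * (y $ j)\<^sup>2)"
      by (simp add: inner_vec_def matrix_vector_mult_def C if_distrib[of "\<lambda>x. x * _"] if_distrib[of "\<lambda>x. _ * x"] power2_eq_square mult_ac cong: if_cong)
    finally show ?thesis .
  qed
  have d_pos: "d j > 0" for j
    unfolding d_def C_def using M(1) by (intro pos_def_congruence_diagonal pos) simp
  have detB: "det B = (\<Prod>j\<in>UNIV. d j)"
  proof -
    have "det C = (\<Prod>j\<in>UNIV. C $ j $ j)" by (rule det_diagonal) (simp add: C)
    then show ?thesis using M(1) by (simp add: C_def det_mul d_def)
  qed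
  have A: "A $ i $ j = (\<Sum>k\<in>UNIV. M $ i $ k * M $ j $ k / d k)" for i j
  proof -
    define D :: "real ^ 'n ^ 'n" where "D = (\<chi> i j. if i = j then 1 / d i else 0)"
    have "C ** D = mat 1"
      using d_pos[THEN less_imp_neq]
      by (auto simp: vec_eq_iff matrix_matrix_mult_def C D_def mat_def if_distrib[of "\<lambda>x. x * _"] cong: if_cong)
    then have "transpose M ** (B ** M ** D) = mat 1" by (simp add: C_def matrix_mul_assoc)
    then have "(B ** M ** D) ** transpose M = mat 1" by (rule matrix_left_right_inverse[THEN iffD1])
    then have "A ** (B ** M ** D ** transpose M) = A" by simp
    then have "A = M ** D ** transpose M" by (simp add: matrix_mul_assoc AB)
    moreover have "(M ** D) $ i $ k = M $ i $ k / d k" for i k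
      by (simp add: matrix_matrix_mult_def D_def if_distrib[of "\<lambda>x. _ * x"] cong: if_cong)
    ultimately show ?thesis by (simp add: matrix_matrix_mult_def[of "M ** D"] transpose_def)
  qed
  define c where "c = (\<lambda>j. \<Sum>i\<in>UNIV. v $ i * complex_of_real (M $ i $ j))"
  \<comment> \<open>the root of \<open>s d\<^sub>j\<close> in the right half-plane, so that the product of the \<open>a j\<close> is \<open>csqrt s ^ n * sqrt (det B)\<close>\<close>
  define a where "a = (\<lambda>j. csqrt s * of_real (sqrt (d j)))"
  have a_sector: "\<bar>Im (a j)\<bar> < Re (a j)" for j
    using csqrt_in_sector[OF s] d_pos[of j] by (simp add: a_def abs_mult)
  have a2: "(a j)\<^sup>2 = s * of_real (d j)" for j
    using d_pos[of j] by (simp add: a_def power_mult_distrib flip: of_real_power)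
  let ?F = "\<lambda>w. exp (- (of_real pi * s * of_real (w \<bullet> (B *v w))) - 2 * of_real pi * \<i> * cbilin v (cvec w))"
  have c: "cbilin v (cvec (M *v y)) = (\<Sum>j\<in>UNIV. c j * of_real (y $ j))" for y
    by (simp add: cbilin_cvec_matrix_vector c_def)
  have F: "?F (M *v y) = (\<Prod>j\<in>UNIV. exp (- (of_real pi * (a j)\<^sup>2 * (of_real (y $ j))\<^sup>2) - 2 * of_real pi * \<i> * c j * of_real (y $ j)))" for y
    by (simp add: exp_sum[symmetric] form c a2 sum_subtractf sum_negf sum_distrib_left mult_ac)
  have quad: "cbilin v (cmat A *v v) = (\<Sum>k\<in>UNIV. (c k)\<^sup>2 / of_real (d k))"
  proof -
    have "cbilin v (cmat A *v v) = (\<Sum>i\<in>UNIV. \<Sum>j\<in>UNIV. \<Sum>k\<in>UNIV. v $ i * of_real (M $ i $ k) * (v $ j * of_real (M $ j $ k)) / of_real (d k))"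
      by (simp add: cbilin_def matrix_vector_mult_def map_matrix_def A sum_distrib_left sum_distrib_right mult_ac)
    also have "\<dots> = (\<Sum>k\<in>UNIV. \<Sum>i\<in>UNIV. \<Sum>j\<in>UNIV. v $ i * of_real (M $ i $ k) * (v $ j * of_real (M $ j $ k)) / of_real (d k))"
      by (subst sum.swap, subst sum.swap) (intro sum.cong refl sum.swap)
    also have "\<dots> = (\<Sum>k\<in>UNIV. (c k)\<^sup>2 / of_real (d k))"
      by (simp add: c_def power2_eq_square sum_product sum_divide_distrib)
    finally show ?thesis .
  qed
  have "has_bochner_integral lborel (\<lambda>y. ?F (M *v y)) (\<Prod>j\<in>UNIV. exp (- (of_real pi * (c j)\<^sup>2 / (a j)\<^sup>2)) / a j)"
    unfolding F
    by (rule has_bochner_integral_prod_coords[where f = "\<lambda>j y. exp (- (of_real pi * (a j)\<^sup>2 * (of_real y)\<^sup>2) - 2 * of_real pi * \<i> * c j * of_real y)"])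
      (rule gaussian_fourier_real_line[OF a_sector])
  also have "(\<Prod>j\<in>UNIV. exp (- (of_real pi * (c j)\<^sup>2 / (a j)\<^sup>2)) / a j) =
     exp (- (of_real pi / s * cbilin v (cmat A *v v))) / (csqrt s ^ CARD('n) * of_real (sqrt (det B)))"
  proof -
    have "sqrt (\<Prod>j\<in>S. d j) = (\<Prod>j\<in>S. sqrt (d j))" for S
      by (induction S rule: infinite_finite_induct) (simp_all add: real_sqrt_mult)
    then show ?thesis
      by (simp only: a2) (simp add: prod_dividef exp_sum[symmetric] sum_negf quad a_def prod.distrib detB sum_distrib_left)
  qed
  finally have int: "has_bochner_integral lborel (\<lambda>y. ?F (M *v y))
     (exp (- (of_real pi / s * cbilin v (cmat A *v v))) / (csqrt s ^ CARD('n) * of_real (sqrt (det B))))" .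
  have "continuous_on UNIV (\<lambda>w. B *v w)" by (simp add: linear_continuous_on linear_linear)
  then have "continuous_on UNIV ?F"
    unfolding cbilin_def cvec_def by (auto intro!: continuous_intros)
  then have meas: "?F \<in> borel_measurable borel" by (rule borel_measurable_continuous_onI)
  have measM: "(*v) M \<in> lborel \<rightarrow>\<^sub>M borel"
    by (simp add: borel_measurable_continuous_onI linear_continuous_on linear_linear)
  show ?thesis
    using int unfolding has_bochner_integral_iff
    using integrable_distr_eq[OF measM meas] integral_distr[OF measM meas] by (simp add: M(2))
qed

section \<open>Exchanging summation and integration\<close>

lemma has_bochner_integral_infsum:
  fixes f :: "'i \<Rightarrow> 'a \<Rightarrow> 'b::{banach, second_countable_topology}"
  assumes S: "countable S"
    and f: "\<And>i. i \<in> S \<Longrightarrow> integrable M (f i)"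
    and pointwise: "\<And>x. (\<lambda>i. norm (f i x)) summable_on S"
    and total: "(\<lambda>i. LINT x|M. norm (f i x)) summable_on S"
  shows "has_bochner_integral M (\<lambda>x. \<Sum>\<^sub>\<infinity>i\<in>S. f i x) (\<Sum>\<^sub>\<infinity>i\<in>S. integral\<^sup>L M (f i))"
proof (cases "finite S")
  case True
  then show ?thesis using f by (simp add: has_bochner_integral_iff)
next
  case False
  define e where "e = from_nat_into S"
  have e: "bij_betw e UNIV S" unfolding e_def using S False by (rule bij_betw_from_nat_into)
  have eS: "e n \<in> S" for n using e by (auto simp: bij_betw_def)
  have sum1: "summable (\<lambda>n. norm (f (e n) x))" for x
    using summable_on_reindex_bij_betw[OF e, of "\<lambda>i. norm (f i x)"] pointwise
    by (simp add: summable_on_imp_summable)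
  have sum2: "summable (\<lambda>n. LINT x|M. norm (f (e n) x))"
    using summable_on_reindex_bij_betw[OF e, of "\<lambda>i. LINT x|M. norm (f i x)"] total
    by (simp add: summable_on_imp_summable)
  have "(\<Sum>\<^sub>\<infinity>i\<in>S. f i x) = (\<Sum>n. f (e n) x)" for x
    using norm_summable_imp_has_sum[OF sum1 summable_sums[OF summable_norm_cancel[OF sum1]]]
    by (simp add: infsumI flip: infsum_reindex_bij_betw[OF e])
  moreover have "(\<Sum>\<^sub>\<infinity>i\<in>S. integral\<^sup>L M (f i)) = (\<Sum>n. integral\<^sup>L M (f (e n)))"
  proof -
    have "summable (\<lambda>n. norm (integral\<^sup>L M (f (e n))))"
      by (rule summable_comparison_test'[OF sum2, of 0]) simp
    from norm_summable_imp_has_sum[OF this summable_sums[OF summable_norm_cancel[OF this]]]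
    show ?thesis by (simp add: infsumI flip: infsum_reindex_bij_betw[OF e])
  qed
  ultimately show ?thesis
    using integrable_suminf[of M "\<lambda>n. f (e n)"] integral_suminf[of M "\<lambda>n. f (e n)"] f eS sum1 sum2
    by (simp add: has_bochner_integral_iff)
qed

lemma norm_summable_on_prod_UNIV:
  fixes f :: "'n::finite \<Rightarrow> 'b::countable \<Rightarrow> 'c::{real_normed_field,banach,second_countable_topology}"
  assumes "\<And>j. (\<lambda>m. norm (f j m)) summable_on UNIV"
  shows "(\<lambda>m. norm (\<Prod>j\<in>UNIV. f j (m j))) summable_on UNIV"
proof -
  have "Infinite_Set_Sum.abs_summable_on (\<lambda>m. \<Prod>j\<in>UNIV. f j (m j)) (PiE UNIV (\<lambda>_. UNIV))"
    using assms by (intro abs_summable_on_prod_PiE) (auto simp flip: abs_summable_equivalent)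
  then show ?thesis by (simp flip: abs_summable_equivalent)
qed

section \<open>The regularized partial theta function\<close>

text \<open>With \<open>p = e^{\<pi>\<i>z}\<close>, of modulus below \<open>1\<close>, the terms are \<open>p, p\<^sup>3, p\<^sup>5, \<dots>\<close>; their sum is
\<open>p/(1 - p\<^sup>2) = 1/(p\<^sup>-\<^sup>1 - p)\<close>, and \<open>p - p\<^sup>-\<^sup>1 = 2\<i> sin \<pi>z\<close>.\<close>

lemma half_integer_geometric_series:
  fixes z :: complex
  assumes z: "Im z > 0"
  shows "(\<lambda>m::nat. norm (exp (2 * of_real pi * \<i> * (of_nat m + 1 / 2) * z))) summable_on UNIV"
    and "(\<Sum>\<^sub>\<infinity>m::nat. exp (2 * of_real pi * \<i> * (of_nat m + 1 / 2) * z)) = - 1 / (2 * \<i> * sin (of_real pi * z))"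
proof -
  define p where "p = exp (\<i> * (of_real pi * z))"
  have p: "norm p < 1" using z by (simp add: p_def norm_exp_eq_Re)
  have eq: "exp (2 * of_real pi * \<i> * (of_nat m + 1 / 2) * z) = p * (p\<^sup>2) ^ m" for m
  proof -
    have "p * (p\<^sup>2) ^ m = exp (\<i> * (of_real pi * z) + of_nat (2 * m) * (\<i> * (of_real pi * z)))"
      unfolding p_def exp_add exp_of_nat_mult power_mult ..
    also have "\<i> * (of_real pi * z) + of_nat (2 * m) * (\<i> * (of_real pi * z)) = 2 * of_real pi * \<i> * (of_nat m + 1 / 2) * z"
      by (simp add: field_simps)
    finally show ?thesis ..
  qed
  have p2: "norm (p\<^sup>2) < 1" using p by (simp add: norm_power power_less_one_iff)
  have sum: "summable (\<lambda>m. norm (p * (p\<^sup>2) ^ m))"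
    unfolding norm_mult norm_power[of "p\<^sup>2"] using p2 by (intro summable_mult summable_geometric) simp
  have sums: "(\<lambda>m. p * (p\<^sup>2) ^ m) sums (p * (1 / (1 - p\<^sup>2)))"
    by (intro sums_mult geometric_sums p2)
  show "(\<lambda>m::nat. norm (exp (2 * of_real pi * \<i> * (of_nat m + 1 / 2) * z))) summable_on UNIV"
    unfolding eq using sum by (simp add: summable_on_UNIV_nonneg_real_iff)
  have "(\<Sum>\<^sub>\<infinity>m::nat. exp (2 * of_real pi * \<i> * (of_nat m + 1 / 2) * z)) = p * (1 / (1 - p\<^sup>2))"
    unfolding eq using norm_summable_imp_has_sum[OF sum sums] by (rule infsumI)
  also have "\<dots> = - 1 / (2 * \<i> * sin (of_real pi * z))"
  proof -
    have "p \<noteq> 0" by (simp add: p_def)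
    moreover have "1 - p\<^sup>2 \<noteq> 0" using p2 by auto
    moreover from \<open>p \<noteq> 0\<close> have "2 * \<i> * sin (of_real pi * z) = - (1 - p\<^sup>2) / p"
      by (simp add: sin_exp_eq p_def exp_minus power2_eq_square field_simps)
    ultimately show ?thesis by (simp only:) (simp add: field_simps)
  qed
  finally show "(\<Sum>\<^sub>\<infinity>m::nat. exp (2 * of_real pi * \<i> * (of_nat m + 1 / 2) * z)) = - 1 / (2 * \<i> * sin (of_real pi * z))" .
qed

lemma bij_betw_half_int_cone:
  "bij_betw (\<lambda>m. \<chi> j. of_nat (m j) + 1 / 2) (UNIV :: ('n::finite \<Rightarrow> nat) set) half_int_cone"
proof (rule bij_betwI')
  fix k :: "complex ^ 'n" assume "k \<in> half_int_cone"
  then obtain m where "\<And>j. k $ j = of_nat (m j) + 1 / 2" unfolding half_int_cone_def by auto metis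
  then have "k = (\<chi> j. of_nat (m j) + 1 / 2)" by (simp add: vec_eq_iff)
  then show "\<exists>m\<in>UNIV. k = (\<chi> j. of_nat (m j) + 1 / 2)" by blast
qed (auto simp: half_int_cone_def vec_eq_iff fun_eq_iff)

lemma pos_def_matrix_inverse:
  fixes A :: "real ^ 'n ^ 'n"
  assumes sym: "transpose A = A" and pos: "pos_def_matrix A"
  shows "A ** matrix_inv A = mat 1" "transpose (matrix_inv A) = matrix_inv A" "pos_def_matrix (matrix_inv A)"
proof -
  have "x = 0" if "A *v x = 0" for x
    using pos that by (metis inner_zero_right less_irrefl pos_def_matrix_def)
  then have inv: "invertible A"
    by (simp add: invertible_left_inverse matrix_left_invertible_ker)
  then have 1: "A ** matrix_inv A = mat 1" "matrix_inv A ** A = mat 1"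
    using someI_ex[of "\<lambda>B. A ** B = mat 1 \<and> B ** A = mat 1"] by (auto simp: invertible_def matrix_inv_def)
  show "A ** matrix_inv A = mat 1" by fact
  have "transpose (matrix_inv A) ** A = mat 1"
    using arg_cong[OF 1(1), of transpose] by (simp add: matrix_transpose_mul sym)
  then have "transpose (matrix_inv A) ** A ** matrix_inv A = matrix_inv A" by simp
  then show "transpose (matrix_inv A) = matrix_inv A" by (simp add: matrix_mul_assoc[symmetric] 1)
  show "pos_def_matrix (matrix_inv A)"
    unfolding pos_def_matrix_def
  proof (intro allI impI)
    fix x :: "real ^ 'n" assume x: "x \<noteq> 0"
    have Ax: "A *v (matrix_inv A *v x) = x" by (simp add: matrix_vector_mul_assoc 1)
    with x have "matrix_inv A *v x \<noteq> 0" by auto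
    then have "0 < (matrix_inv A *v x) \<bullet> (A *v (matrix_inv A *v x))"
      using pos by (simp add: pos_def_matrix_def)
    then show "0 < x \<bullet> (matrix_inv A *v x)" unfolding Ax by (simp add: inner_commute)
  qed
qed

lemma cbilin_cmat_sym:
  fixes A :: "real ^ 'n ^ 'n"
  assumes "transpose A = A"
  shows "cbilin x (cmat A *v y) = cbilin y (cmat A *v x)"
proof -
  have A: "A $ i $ j = A $ j $ i" for i j using assms by (metis transpose_def vec_lambda_beta)
  have "cbilin x (cmat A *v y) = (\<Sum>i\<in>UNIV. \<Sum>j\<in>UNIV. x $ i * (of_real (A $ i $ j) * y $ j))"
    by (simp add: cbilin_def matrix_vector_mult_def map_matrix_def sum_distrib_left)
  also have "\<dots> = (\<Sum>j\<in>UNIV. \<Sum>i\<in>UNIV. x $ i * (of_real (A $ i $ j) * y $ j))" by (rule sum.swap)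
  also have "\<dots> = cbilin y (cmat A *v x)"
    by (simp add: cbilin_def matrix_vector_mult_def map_matrix_def sum_distrib_left A mult_ac)
  finally show ?thesis .
qed

lemma cbilin_cmat_cvec: "cbilin (cvec w) (cmat B *v cvec w) = of_real (w \<bullet> (B *v w))"
  by (simp add: cbilin_def cvec_def matrix_vector_mult_def map_matrix_def inner_vec_def)

lemma cbilin_diff_left: "cbilin (x - y) z = cbilin x z - cbilin y z"
  and cbilin_diff_right: "cbilin x (y - z) = cbilin x y - cbilin x z"
  and cbilin_scale_right: "cbilin x (a *s y) = a * cbilin x y"
  by (simp_all add: cbilin_def algebra_simps sum_subtractf sum_distrib_left)

text \<open>The summand at \<open>k\<close>, without its factor \<open>e^{2\<pi>(k,\<epsilon>)}\<close>, is, up to a constant, a Fourier integral in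
which \<open>k\<close> enters only through the character \<open>e^{2\<pi>\<i>(k,w)}\<close>. This is \<open>gaussian_fourier\<close> for the
form \<open>A\<^sup>-\<^sup>1\<close> at \<open>u - k\<close>, after expanding \<open>(u-k,A(u-k))\<close>.\<close>

lemma partial_theta_term:
  fixes A :: "real ^ 'n ^ 'n" and k u :: "complex ^ 'n"
  assumes sym: "transpose A = A" and pos: "pos_def_matrix A" and \<tau>: "Im \<tau> > 0"
  shows "has_bochner_integral lborel
     (\<lambda>w. q_pow \<tau> (1 / 2 * cbilin (cvec w) (cmat (matrix_inv A) *v cvec w))
            * exp (- 2 * of_real pi * \<i> * cbilin u (cvec w)) * exp (2 * of_real pi * \<i> * cbilin k (cvec w)))
     (q_pow (- 1 / \<tau>) (1 / 2 * cbilin k (cmat A *v k))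
        * exp (2 * of_real pi * \<i> * cbilin k (cmat A *v (\<chi> j. u $ j / \<tau>)))
        / (exp (of_real pi * \<i> / \<tau> * cbilin u (cmat A *v u)) * (csqrt (- \<i> * \<tau>) ^ CARD('n) / of_real (sqrt (det A)))))"
proof -
  define s where "s = - \<i> * \<tau>"
  have s: "Re s > 0" using \<tau> by (simp add: s_def)
  have [simp]: "\<tau> \<noteq> 0" using \<tau> by auto
  note B = pos_def_matrix_inverse[OF sym pos]
  have "det A * det (matrix_inv A) = 1" using B(1) by (metis det_I det_mul)
  then have detB: "det (matrix_inv A) = 1 / det A" by (metis mult_eq_0_iff nonzero_mult_div_cancel_left zero_neq_one)
  have scaled: "(\<chi> j. u $ j / \<tau>) = (1 / \<tau>) *s u" by (simp add: vec_eq_iff)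
  have "has_bochner_integral lborel
     (\<lambda>w. exp (- (of_real pi * s * of_real (w \<bullet> (matrix_inv A *v w))) - 2 * of_real pi * \<i> * cbilin (u - k) (cvec w)))
     (exp (- (of_real pi / s * cbilin (u - k) (cmat A *v (u - k)))) / (csqrt s ^ CARD('n) * of_real (sqrt (det (matrix_inv A)))))"
    by (rule gaussian_fourier[OF B(2,3,1) s])
  also have "(\<lambda>w. exp (- (of_real pi * s * of_real (w \<bullet> (matrix_inv A *v w))) - 2 * of_real pi * \<i> * cbilin (u - k) (cvec w)))
     = (\<lambda>w. q_pow \<tau> (1 / 2 * cbilin (cvec w) (cmat (matrix_inv A) *v cvec w))
            * exp (- 2 * of_real pi * \<i> * cbilin u (cvec w)) * exp (2 * of_real pi * \<i> * cbilin k (cvec w)))"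
    unfolding q_pow_def exp_add[symmetric] cbilin_cmat_cvec cbilin_diff_left
    by (intro ext arg_cong[where f = exp]) (simp add: s_def algebra_simps)
  also have "exp (- (of_real pi / s * cbilin (u - k) (cmat A *v (u - k)))) =
     q_pow (- 1 / \<tau>) (1 / 2 * cbilin k (cmat A *v k))
        * exp (2 * of_real pi * \<i> * cbilin k (cmat A *v (\<chi> j. u $ j / \<tau>)))
        / exp (of_real pi * \<i> / \<tau> * cbilin u (cmat A *v u))"
    unfolding q_pow_def exp_add[symmetric] exp_diff[symmetric] scaled vector_scalar_commute
      matrix_vector_mult_diff_distrib cbilin_diff_left cbilin_diff_right cbilin_scale_right
      cbilin_cmat_sym[OF sym, of u k]
    by (rule arg_cong[where f = exp]) (simp add: s_def field_simps)
  also have "csqrt s ^ CARD('n) * of_real (sqrt (det (matrix_inv A))) = csqrt (- \<i> * \<tau>) ^ CARD('n) / of_real (sqrt (det A))"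
    by (simp add: s_def detB real_sqrt_divide)
  finally show ?thesis by (simp only: divide_divide_eq_left)
qed

theorem theorem5:
  fixes A :: "real ^ 'n ^ 'n" and u \<epsilon> :: "complex ^ 'n" and \<tau> :: complex
  assumes "\<forall>i j. A $ i $ j \<in> \<int>"
    and "transpose A = A"
    and "pos_def_matrix A"
    and "Im \<tau> > 0"
    and "\<forall>j. Re (\<epsilon> $ j) < 0"
  shows "partial_theta A \<epsilon> (\<chi> j. u $ j / \<tau>) (- 1 / \<tau>)
           = (- 1) ^ CARD('n) * theta_integral A \<epsilon> u \<tau>"
proof -
  \<comment> \<open>\<open>g\<close> is the part of the integrand without \<open>k\<close>, \<open>1 / K\<close> the constant of \<open>partial_theta_term\<close>, \<open>h\<close> parametrizes
    the cone, \<open>t\<close> is the summand of the theta function, and \<open>e w m\<close> is the factor that carries \<open>k = h m\<close>\<close>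
  define g where "g = (\<lambda>w :: real ^ 'n. q_pow \<tau> (1 / 2 * cbilin (cvec w) (cmat (matrix_inv A) *v cvec w))
      * exp (- 2 * of_real pi * \<i> * cbilin u (cvec w)))"
  define K where "K = exp (of_real pi * \<i> / \<tau> * cbilin u (cmat A *v u)) * (csqrt (- \<i> * \<tau>) ^ CARD('n) / of_real (sqrt (det A)))"
  define h :: "('n \<Rightarrow> nat) \<Rightarrow> complex ^ 'n" where "h = (\<lambda>m. \<chi> j. of_nat (m j) + 1 / 2)"
  define z where "z = (\<lambda>(w :: real ^ 'n) j. cvec w $ j - \<i> * \<epsilon> $ j)"
  define e where "e = (\<lambda>(w :: real ^ 'n) (m :: 'n \<Rightarrow> nat). \<Prod>j\<in>UNIV. exp (2 * of_real pi * \<i> * (of_nat (m j) + 1 / 2) * z w j))"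
  define t where "t = (\<lambda>k. q_pow (- 1 / \<tau>) (1 / 2 * cbilin k (cmat A *v k))
        * exp (2 * of_real pi * \<i> * cbilin k (cmat A *v (\<chi> j. u $ j / \<tau>)))
        * exp (2 * of_real pi * cbilin k \<epsilon>))"
  have "det A \<noteq> 0"
    using pos_def_matrix_inverse(1)[OF assms(2,3)] by (metis det_I det_mul mult_zero_left zero_neq_one)
  moreover have "\<tau> \<noteq> 0" using assms(4) by auto
  ultimately have [simp]: "K \<noteq> 0" by (simp add: K_def)
  have Im_z: "Im (z w j) > 0" for w j using assms(5) by (simp add: z_def cvec_def)
  have e_split: "e w m = exp (2 * of_real pi * \<i> * cbilin (h m) (cvec w)) * exp (2 * of_real pi * cbilin (h m) \<epsilon>)" for w m
  proof -
    have "e w m = exp (\<Sum>j\<in>UNIV. 2 * of_real pi * \<i> * (h m $ j * cvec w $ j) + 2 * of_real pi * (h m $ j * \<epsilon> $ j))"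
      unfolding e_def exp_sum[OF finite, symmetric]
      by (intro arg_cong[where f = exp] sum.cong) (simp_all add: z_def h_def field_simps)
    then show ?thesis by (simp add: sum.distrib exp_add cbilin_def flip: sum_distrib_left)
  qed
  \<comment> \<open>only the imaginary parts of the \<open>z w j\<close> matter for the modulus, and these are \<open>- Re \<epsilon>\<^sub>j\<close>: this uniformity
    in \<open>w\<close> bounds the sum over \<open>m\<close> of the integrals of the moduli\<close>
  have norm_e: "norm (e w m) = norm (e 0 m)" for w m
    by (simp add: e_def z_def cvec_def norm_exp_eq_Re flip: prod_norm)
  have summable_e: "(\<lambda>m. norm (e w m)) summable_on UNIV" for w
    unfolding e_def by (intro norm_summable_on_prod_UNIV half_integer_geometric_series(1) Im_z)
  have int_term: "has_bochner_integral lborel (\<lambda>w. g w * e w m) (t (h m) / K)" for m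
  proof -
    have "has_bochner_integral lborel (\<lambda>w. g w * exp (2 * of_real pi * \<i> * cbilin (h m) (cvec w)) * exp (2 * of_real pi * cbilin (h m) \<epsilon>))
        (q_pow (- 1 / \<tau>) (1 / 2 * cbilin (h m) (cmat A *v h m))
          * exp (2 * of_real pi * \<i> * cbilin (h m) (cmat A *v (\<chi> j. u $ j / \<tau>))) / K * exp (2 * of_real pi * cbilin (h m) \<epsilon>))"
      unfolding g_def K_def by (intro has_bochner_integral_mult_left partial_theta_term assms)
    then show ?thesis by (simp only: e_split t_def mult.assoc times_divide_eq_left)
  qed
  \<comment> \<open>the case \<open>k = 0\<close>\<close>
  have int_g: "integrable lborel g"
    using partial_theta_term[OF assms(2-4), of u 0] by (simp add: g_def cbilin_def has_bochner_integral_iff)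
  have "has_bochner_integral lborel (\<lambda>w. \<Sum>\<^sub>\<infinity>m. g w * e w m) (\<Sum>\<^sub>\<infinity>m. LINT w|lborel. g w * e w m)"
  proof (rule has_bochner_integral_infsum)
    show "(\<lambda>m. norm (g w * e w m)) summable_on UNIV" for w
      unfolding norm_mult by (intro summable_on_cmult_right summable_e)
    have "norm (g w * e w m) = norm (g w) * norm (e 0 m)" for w m
      using norm_e[of w m] by (simp add: norm_mult)
    then have "(LINT w|lborel. norm (g w * e w m)) = (LINT w|lborel. norm (g w)) * norm (e 0 m)" for m
      by simp
    then show "(\<lambda>m. LINT w|lborel. norm (g w * e w m)) summable_on UNIV"
      by (simp add: summable_on_cmult_right summable_e)
  qed (use int_term in \<open>auto simp: has_bochner_integral_iff\<close>)
  then have swap: "(LINT w|lborel. (\<Sum>\<^sub>\<infinity>m. g w * e w m)) = (\<Sum>\<^sub>\<infinity>m. t (h m) / K)"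
    using int_term by (simp add: has_bochner_integral_iff)
  have geom: "(\<Sum>\<^sub>\<infinity>m. g w * e w m) = (- 1 / (2 * \<i>)) ^ CARD('n) * (g w / (\<Prod>j\<in>UNIV. sin (of_real pi * z w j)))" for w
  proof -
    have "(\<Sum>\<^sub>\<infinity>m. e w m) = (\<Prod>j\<in>UNIV. \<Sum>\<^sub>\<infinity>m::nat. exp (2 * of_real pi * \<i> * (of_nat m + 1 / 2) * z w j))"
      using infsum_prod_PiE_abs[of "UNIV :: 'n set" "\<lambda>j m. exp (2 * of_real pi * \<i> * (of_nat m + 1 / 2) * z w j)" "\<lambda>_. UNIV"]
        half_integer_geometric_series(1)[OF Im_z] by (simp add: e_def)
    also have "\<dots> = (\<Prod>j\<in>UNIV. (- 1 / (2 * \<i>)) / sin (of_real pi * z w j))"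
      by (simp only: half_integer_geometric_series(2)[OF Im_z] divide_divide_eq_left)
    also have "\<dots> = (- 1 / (2 * \<i>)) ^ CARD('n) / (\<Prod>j\<in>UNIV. sin (of_real pi * z w j))"
      by (simp only: prod_dividef prod_constant power_divide)
    finally show ?thesis
      by (subst infsum_cmult_right') (simp only: times_divide_eq_right mult.commute)
  qed
  have "partial_theta A \<epsilon> (\<chi> j. u $ j / \<tau>) (- 1 / \<tau>) = (\<Sum>\<^sub>\<infinity>m. t (h m))"
    unfolding partial_theta_def t_def h_def by (rule infsum_reindex_bij_betw[OF bij_betw_half_int_cone, symmetric])
  also have "\<dots> = K * (\<Sum>\<^sub>\<infinity>m. t (h m) / K)"
    by (subst infsum_cmult_right'[symmetric]) simp
  also have "\<dots> = K * ((- 1 / (2 * \<i>)) ^ CARD('n) * (LINT w|lborel. g w / (\<Prod>j\<in>UNIV. sin (of_real pi * z w j))))"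
    unfolding swap[symmetric] geom integral_mult_right_zero ..
  also have "(- 1 / (2 * \<i>)) ^ CARD('n) = (- 1) ^ CARD('n) * (1 / (2 * \<i>) ^ CARD('n))"
    by (simp only: power_divide times_divide_eq_right mult_1_right)
  also have "K * ((- 1) ^ CARD('n) * (1 / (2 * \<i>) ^ CARD('n)) * (LINT w|lborel. g w / (\<Prod>j\<in>UNIV. sin (of_real pi * z w j))))
      = (- 1) ^ CARD('n) * theta_integral A \<epsilon> u \<tau>"
    unfolding theta_integral_def K_def g_def z_def by (simp only: mult_ac)
  finally show ?thesis .
qed

end
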